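(* Consider a relative equilibrium of the $n$-body problem on $\mathbb{S}^2$ with positive masses $m_1,\dots,m_n$ and angular velocity $\omega$. If $\omega\neq 0$, then the rotation axis (the $z$-axis of the spherical coordinate system in which $\dot\theta_k=0$ and $\phi_k(t)=\phi_k(0)+\omega t$ for all $k$) is one of the principal axes of the inertia tensor $I$, i.e. $e_z=(0,0,1)^T$ is an eigenvector of $I$.
   Context: $n$ point masses $m_k>0$ move on the unit sphere $\mathbb{S}^2\subset\mathbb{R}^3$ (radius $R=1$), with positions $q_k=(X_k,Y_k,Z_k)=(\sin\theta_k\cos\phi_k,\sin\theta_k\sin\phi_k,\cos\theta_k)$. The arc angle $\sigma_{ij}\in[0,\pi]$ satisfies $\cos\sigma_{ij}=\cos\theta_i\cos\theta_j+\sin\theta_i\sin\theta_j\cos(\phi_i-\phi_j)$. The equations of motion are the Euler-Lagrange equations of $L=\sum_k\frac{m_k}{2}(\dot\theta_k^2+\sin^2(\theta_k)\dot\phi_k^2)+\sum_{i<j}m_im_jU(\cos\sigma_{ij})$, where $U'(\cos\sigma)=dU/d(\cos\sigma)$ is continuous and has a definite sign for $\sigma\in(0,\pi)$ (bodies are never coincident or antipodal). The angular momentum $\mathbf{c}=\sum_k m_k q_k\times\dot q_k$ is a first integral. A relative equilibrium is a solution of the equations of motion for which, for a proper choice of the $z$-axis of the spherical coordinates, $\dot\theta_k=0$ and $\phi_k(t)=\phi_k(0)+\omega t$ for all $k$, with $\omega$ constant. The inertia tensor is the symmetric $3\times3$ matrix $I$ with diagonal entries $I_{xx}=\sum_k m_k(Y_k^2+Z_k^2)$,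 $I_{yy}=\sum_k m_k(Z_k^2+X_k^2)$, $I_{zz}=\sum_k m_k(X_k^2+Y_k^2)$ and off-diagonal entries $I_{xy}=-\sum_k m_kX_kY_k$, $I_{xz}=-\sum_k m_kX_kZ_k$, $I_{yz}=-\sum_k m_kY_kZ_k$. Its principal axes are the directions of its eigenvectors. *)

theory Defs
  imports "HOL-Analysis.Analysis"
begin

text \<open>Bodies are indexed by \<open>k < n\<close>; values at indices \<open>k \<ge> n\<close> are irrelevant.\<close>

section \<open>Spherical coordinates\<close>

definition sph :: "real \<Rightarrow> real \<Rightarrow> real ^ 3" where
  "sph \<theta> \<phi> = vector [sin \<theta> * cos \<phi>, sin \<theta> * sin \<phi>, cos \<theta>]"

definition arc_angle :: "real \<Rightarrow> real \<Rightarrow> real \<Rightarrow> real \<Rightarrow> real" where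
  "arc_angle \<theta>\<^sub>1 \<phi>\<^sub>1 \<theta>\<^sub>2 \<phi>\<^sub>2 =
     arccos (cos \<theta>\<^sub>1 * cos \<theta>\<^sub>2 + sin \<theta>\<^sub>1 * sin \<theta>\<^sub>2 * cos (\<phi>\<^sub>1 - \<phi>\<^sub>2))"

text \<open>
  The rows of the rotation matrix \<open>R\<close> are the axes of the coordinate system, so \<open>R *v x\<close> is
  the triple of Cartesian coordinates of \<open>x\<close> in that system.
\<close>

definition spherical_coords_on ::
  "real set \<Rightarrow> real ^ 3 ^ 3 \<Rightarrow> nat \<Rightarrow> (nat \<Rightarrow> real \<Rightarrow> real ^ 3) \<Rightarrow>
     (nat \<Rightarrow> real \<Rightarrow> real) \<Rightarrow> (nat \<Rightarrow> real \<Rightarrow> real) \<Rightarrow> bool" where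
  "spherical_coords_on J R n q \<theta> \<phi> \<longleftrightarrow> rotation_matrix R \<and>
     (\<forall>k<n. \<forall>t\<in>J. 0 \<le> \<theta> k t \<and> \<theta> k t \<le> pi \<and> R *v q k t = sph (\<theta> k t) (\<phi> k t))"

section \<open>Lagrangian and Euler-Lagrange equations\<close>

text \<open>The interaction is a function \<open>U\<close> of \<open>cos \<sigma>\<close>, so \<open>deriv U\<close> is \<open>dU / d(cos \<sigma>)\<close>.\<close>

definition admissible_potential :: "(real \<Rightarrow> real) \<Rightarrow> bool" where
  "admissible_potential U \<longleftrightarrow>
     (\<forall>\<sigma>\<in>{0<..<pi}. U differentiable (at (cos \<sigma>))) \<and>
     continuous_on {0<..<pi} (\<lambda>\<sigma>. deriv U (cos \<sigma>)) \<and>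
     ((\<forall>\<sigma>\<in>{0<..<pi}. deriv U (cos \<sigma>) > 0) \<or> (\<forall>\<sigma>\<in>{0<..<pi}. deriv U (cos \<sigma>) < 0))"

text \<open>The arguments \<open>u\<close> and \<open>v\<close> are the velocities belonging to \<open>\<theta>\<close> and \<open>\<phi>\<close>.\<close>

definition lagrangian ::
  "nat \<Rightarrow> (nat \<Rightarrow> real) \<Rightarrow> (real \<Rightarrow> real) \<Rightarrow>
     (nat \<Rightarrow> real) \<Rightarrow> (nat \<Rightarrow> real) \<Rightarrow> (nat \<Rightarrow> real) \<Rightarrow> (nat \<Rightarrow> real) \<Rightarrow> real" where
  "lagrangian n m U \<theta> \<phi> u v =
     (\<Sum>k<n. m k / 2 * ((u k)\<^sup>2 + (sin (\<theta> k))\<^sup>2 * (v k)\<^sup>2)) +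
     (\<Sum>j<n. \<Sum>i<j. m i * m j * U (cos (arc_angle (\<theta> i) (\<phi> i) (\<theta> j) (\<phi> j))))"

definition partial_deriv :: "((nat \<Rightarrow> real) \<Rightarrow> real) \<Rightarrow> nat \<Rightarrow> (nat \<Rightarrow> real) \<Rightarrow> real" where
  "partial_deriv F k x = deriv (\<lambda>s. F (x(k := s))) (x k)"

definition at_time :: "(nat \<Rightarrow> real \<Rightarrow> real) \<Rightarrow> real \<Rightarrow> nat \<Rightarrow> real" where
  "at_time x t = (\<lambda>k. x k t)"

definition velocity :: "(nat \<Rightarrow> real \<Rightarrow> real) \<Rightarrow> real \<Rightarrow> nat \<Rightarrow> real" where
  "velocity x t = (\<lambda>k. deriv (x k) t)"

definition euler_lagrange_on ::
  "real set \<Rightarrow> nat \<Rightarrow>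
     ((nat \<Rightarrow> real) \<Rightarrow> (nat \<Rightarrow> real) \<Rightarrow> (nat \<Rightarrow> real) \<Rightarrow> (nat \<Rightarrow> real) \<Rightarrow> real) \<Rightarrow>
     (nat \<Rightarrow> real \<Rightarrow> real) \<Rightarrow> (nat \<Rightarrow> real \<Rightarrow> real) \<Rightarrow> bool" where
  "euler_lagrange_on J n L \<theta> \<phi> \<longleftrightarrow> (\<forall>k<n. \<forall>t\<in>J.
     \<theta> k differentiable (at t) \<and> \<phi> k differentiable (at t) \<and>
     ((\<lambda>s. partial_deriv (\<lambda>u. L (at_time \<theta> s) (at_time \<phi> s) u (velocity \<phi> s)) k (velocity \<theta> s))
        has_real_derivative
      partial_deriv (\<lambda>x. L x (at_time \<phi> t) (velocity \<theta> t) (velocity \<phi> t)) k (at_time \<theta> t)) (at t) \<and>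
     ((\<lambda>s. partial_deriv (\<lambda>v. L (at_time \<theta> s) (at_time \<phi> s) (velocity \<theta> s) v) k (velocity \<phi> s))
        has_real_derivative
      partial_deriv (\<lambda>x. L (at_time \<theta> t) x (velocity \<theta> t) (velocity \<phi> t)) k (at_time \<phi> t)) (at t))"

text \<open>
  Spherical coordinates are singular at the poles: for a body with \<open>sin \<theta> = 0\<close> the
  \<open>\<phi>\<close>-equation degenerates to \<open>0 = 0\<close> and a component of the equation of motion is lost.
  The Euler-Lagrange equations on the sphere are therefore imposed around every instant in a
  spherical coordinate system in which no body is at a pole. Such a system always exists, and by
  the covariance of the Euler-Lagrange equations its choice is immaterial.
\<close>

definition solution ::
  "nat \<Rightarrow> (nat \<Rightarrow> real) \<Rightarrow> (real \<Rightarrow> real) \<Rightarrow> (nat \<Rightarrow> real \<Rightarrow> real ^ 3) \<Rightarrow> bool" where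
  "solution n m U q \<longleftrightarrow>
     (\<forall>i<n. \<forall>j<n. i \<noteq> j \<longrightarrow> (\<forall>t. q i t \<noteq> q j t \<and> q i t \<noteq> - q j t)) \<and>
     (\<forall>t. \<exists>J R \<theta> \<phi>. open J \<and> t \<in> J \<and> spherical_coords_on J R n q \<theta> \<phi> \<and>
        (\<forall>k<n. \<forall>s\<in>J. sin (\<theta> k s) \<noteq> 0) \<and>
        euler_lagrange_on J n (lagrangian n m U) \<theta> \<phi>)"

text \<open>
  Relative equilibrium with respect to the coordinate system \<open>R\<close>, whose third axis is the
  rotation axis. Bodies may lie on that axis.
\<close>

definition relative_equilibrium ::
  "nat \<Rightarrow> (nat \<Rightarrow> real) \<Rightarrow> (real \<Rightarrow> real) \<Rightarrow> (nat \<Rightarrow> real \<Rightarrow> real ^ 3) \<Rightarrow>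
     real ^ 3 ^ 3 \<Rightarrow> (nat \<Rightarrow> real \<Rightarrow> real) \<Rightarrow> (nat \<Rightarrow> real \<Rightarrow> real) \<Rightarrow> real \<Rightarrow> bool" where
  "relative_equilibrium n m U q R \<theta> \<phi> \<omega> \<longleftrightarrow>
     solution n m U q \<and> spherical_coords_on UNIV R n q \<theta> \<phi> \<and>
     (\<forall>k<n. \<forall>t. (\<theta> k has_real_derivative 0) (at t) \<and> \<phi> k t = \<phi> k 0 + \<omega> * t)"

section \<open>Inertia tensor\<close>

definition inertia_tensor :: "nat \<Rightarrow> (nat \<Rightarrow> real) \<Rightarrow> (nat \<Rightarrow> real ^ 3) \<Rightarrow> real ^ 3 ^ 3" where
  "inertia_tensor n m x =
    (let Ixx = \<Sum>k<n. m k * ((x k $ 2)\<^sup>2 + (x k $ 3)\<^sup>2);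
         Iyy = \<Sum>k<n. m k * ((x k $ 3)\<^sup>2 + (x k $ 1)\<^sup>2);
         Izz = \<Sum>k<n. m k * ((x k $ 1)\<^sup>2 + (x k $ 2)\<^sup>2);
         Ixy = - (\<Sum>k<n. m k * (x k $ 1) * (x k $ 2));
         Ixz = - (\<Sum>k<n. m k * (x k $ 1) * (x k $ 3));
         Iyz = - (\<Sum>k<n. m k * (x k $ 2) * (x k $ 3))
     in vector [vector [Ixx, Ixy, Ixz],
                vector [Ixy, Iyy, Iyz],
                vector [Ixz, Iyz, Izz]])"

definition eigenvector :: "real ^ 3 ^ 3 \<Rightarrow> real ^ 3 \<Rightarrow> bool" where
  "eigenvector A v \<longleftrightarrow> v \<noteq> 0 \<and> (\<exists>l. A *v v = l *\<^sub>R v)"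

end

theory Submission
  imports Defs
begin

text \<open>
  The idea is conservation of angular momentum. A relative equilibrium turns rigidly, so in the
  frame whose third axis is the rotation axis the body \<open>y = (X, Y, Z)\<close> has acceleration
  \<open>y'' = - \<omega>\<^sup>2 (X, Y, 0)\<close>, and \<open>y \<times> y'' = \<omega>\<^sup>2 (Y Z, - X Z, 0)\<close>. The time derivative of the
  total angular momentum is the mass-weighted sum of these vectors. It vanishes, so for
  \<open>\<omega> \<noteq> 0\<close> both \<open>\<Sum> m Y Z\<close> and \<open>\<Sum> m X Z\<close> are zero. These are, up to sign, the
  entries \<open>I\<^sub>y\<^sub>z\<close> and \<open>I\<^sub>x\<^sub>z\<close> of the inertia tensor, and their vanishing says that \<open>e\<^sub>z\<close> is an
  eigenvector.

  The work lies in deriving the conservation law from the Euler-Lagrange equations, which hold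
  in local charts whose axes are unrelated to the rotation axis. In such a chart the potential
  enters the two equations of body \<open>k\<close> only through the inner products of one vector \<open>F\<^sub>k\<close>
  with the coordinate tangent vectors \<open>\<partial>x/\<partial>\<theta>\<close> and \<open>\<partial>x/\<partial>\<phi>\<close>
  (\<open>partial_deriv_\<theta>\<close>, \<open>partial_deriv_\<phi>\<close>). The two scalar equations then amount to the vector
  equation \<open>(m x \<times> x')' = x \<times> F\<^sub>k\<close> (\<open>angular_momentum_has_torque\<close>). Since the interaction
  depends on \<open>x\<^sub>i \<bullet> x\<^sub>j\<close> only, the torques of each pair cancel (\<open>sum_torque_eq_0\<close>).
  Rotations commute with the cross product, and hence the law holds in every fixed frame
  (\<open>solution_moment_of_accelerations_zero\<close>), in particular in the one of the rotation axis.
\<close>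

section \<open>The moving frame of spherical coordinates\<close>

lemma has_vector_derivative_vector_3:
  fixes f g h :: "real \<Rightarrow> real"
  assumes "(f has_real_derivative f') F" "(g has_real_derivative g') F"
    "(h has_real_derivative h') F"
  shows "((\<lambda>s. vector [f s, g s, h s] :: real ^ 3) has_vector_derivative vector [f', g', h']) F"
proof -
  have split: "(vector [a, b, c] :: real ^ 3)
      = a *\<^sub>R axis 1 1 + b *\<^sub>R axis 2 1 + c *\<^sub>R axis 3 1" for a b c :: real
    by (simp add: vec_eq_iff forall_3 axis_def)
  have sc: "((\<lambda>s. u s *\<^sub>R w) has_vector_derivative u' *\<^sub>R w) F"
    if "(u has_real_derivative u') F" for u u' and w :: "real ^ 3"
    using that unfolding has_real_derivative_iff_has_vector_derivative
    by (rule bounded_linear.has_vector_derivative[OF bounded_linear_scaleR_left])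
  show ?thesis
    unfolding split by (intro has_vector_derivative_add sc assms)
qed

text \<open>
  The partial derivatives of \<open>sph\<close>. The second has length \<open>\<bar>sin \<theta>\<bar>\<close>; leaving it unnormalised makes
  its inner product with a force the generalised force that belongs to \<open>\<phi>\<close>.
\<close>
definition sph_d\<theta> :: "real \<Rightarrow> real \<Rightarrow> real ^ 3" where
  "sph_d\<theta> \<theta> \<phi> = vector [cos \<theta> * cos \<phi>, cos \<theta> * sin \<phi>, - sin \<theta>]"

definition sph_d\<phi> :: "real \<Rightarrow> real \<Rightarrow> real ^ 3" where
  "sph_d\<phi> \<theta> \<phi> = vector [- sin \<theta> * sin \<phi>, sin \<theta> * cos \<phi>, 0]"

lemma inner_3: "x \<bullet> y = x $ 1 * y $ 1 + x $ 2 * y $ 2 + x $ 3 * y $ 3" for x y :: "real ^ 3"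
  by (simp add: inner_vec_def sum_3)

lemma sph_frame:
  "sph_d\<theta> \<theta> \<phi> \<bullet> sph_d\<theta> \<theta> \<phi> = 1" "sph_d\<theta> \<theta> \<phi> \<bullet> sph_d\<phi> \<theta> \<phi> = 0"
  "sph_d\<phi> \<theta> \<phi> \<bullet> sph_d\<theta> \<theta> \<phi> = 0"
  "sph_d\<phi> \<theta> \<phi> \<bullet> sph_d\<phi> \<theta> \<phi> = (sin \<theta>)\<^sup>2"
  unfolding inner_3 sph_d\<theta>_def sph_d\<phi>_def vector_3
  using sin_cos_squared_add[of \<theta>] sin_cos_squared_add[of \<phi>]
  by algebra+

lemma sph_inner_sph:
  "sph \<theta>\<^sub>1 \<phi>\<^sub>1 \<bullet> sph \<theta>\<^sub>2 \<phi>\<^sub>2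
     = cos \<theta>\<^sub>1 * cos \<theta>\<^sub>2 + sin \<theta>\<^sub>1 * sin \<theta>\<^sub>2 * cos (\<phi>\<^sub>1 - \<phi>\<^sub>2)"
  by (simp add: inner_3 sph_def cos_diff algebra_simps)

lemma norm_sph [simp]: "norm (sph \<theta> \<phi>) = 1"
  by (simp add: norm_eq_1 sph_inner_sph)

lemma cos_arc_angle: "cos (arc_angle \<theta>\<^sub>1 \<phi>\<^sub>1 \<theta>\<^sub>2 \<phi>\<^sub>2) = sph \<theta>\<^sub>1 \<phi>\<^sub>1 \<bullet> sph \<theta>\<^sub>2 \<phi>\<^sub>2"
proof -
  have "\<bar>sph \<theta>\<^sub>1 \<phi>\<^sub>1 \<bullet> sph \<theta>\<^sub>2 \<phi>\<^sub>2\<bar> \<le> 1"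
    using Cauchy_Schwarz_ineq2[of "sph \<theta>\<^sub>1 \<phi>\<^sub>1" "sph \<theta>\<^sub>2 \<phi>\<^sub>2"] by simp
  then show ?thesis
    unfolding arc_angle_def sph_inner_sph[symmetric] by (simp add: cos_arccos_abs)
qed

text \<open>
  This is what keeps two distinct, non-antipodal bodies at an arc angle strictly between \<open>0\<close>
  and \<open>\<pi>\<close>, where the potential is differentiable.
\<close>
lemma abs_inner_less_1:
  fixes x y :: "'a :: real_inner"
  assumes "norm x = 1" "norm y = 1" "x \<noteq> y" "x \<noteq> - y"
  shows "\<bar>x \<bullet> y\<bar> < 1"
proof -
  have "\<bar>x \<bullet> y\<bar> \<le> 1"
    using Cauchy_Schwarz_ineq2[of x y] assms by simp
  moreover have "\<bar>x \<bullet> y\<bar> \<noteq> 1"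
    using norm_cauchy_schwarz_abs_eq[of x y] assms by auto
  ultimately show ?thesis by simp
qed

lemma has_vector_derivative_sph:
  assumes "(\<theta> has_real_derivative u) (at t)" "(\<phi> has_real_derivative v) (at t)"
  shows "((\<lambda>s. sph (\<theta> s) (\<phi> s)) has_vector_derivative
      u *\<^sub>R sph_d\<theta> (\<theta> t) (\<phi> t) + v *\<^sub>R sph_d\<phi> (\<theta> t) (\<phi> t)) (at t)"
proof -
  have "((\<lambda>s. sph (\<theta> s) (\<phi> s)) has_vector_derivative
     vector [cos (\<theta> t) * u * cos (\<phi> t) - sin (\<theta> t) * (sin (\<phi> t) * v),
             cos (\<theta> t) * u * sin (\<phi> t) + sin (\<theta> t) * (cos (\<phi> t) * v),
             - sin (\<theta> t) * u]) (at t)"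
    unfolding sph_def
    by (intro has_vector_derivative_vector_3) (auto intro!: derivative_eq_intros assms)
  also have "vector [cos (\<theta> t) * u * cos (\<phi> t) - sin (\<theta> t) * (sin (\<phi> t) * v),
             cos (\<theta> t) * u * sin (\<phi> t) + sin (\<theta> t) * (cos (\<phi> t) * v),
             - sin (\<theta> t) * u] = u *\<^sub>R sph_d\<theta> (\<theta> t) (\<phi> t) + v *\<^sub>R sph_d\<phi> (\<theta> t) (\<phi> t)"
    by (simp add: vec_eq_iff forall_3 sph_d\<theta>_def sph_d\<phi>_def)
  finally show ?thesis .
qed

text \<open>
  A moment about the origin sees \<open>w\<close> only through its two tangential components, and away from
  the poles these are determined by the inner products with the coordinate tangent vectors.
  The same formula thus describes angular momenta (where \<open>w\<close> is a momentum) and torques (where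
  \<open>w\<close> is a force).
\<close>
lemma cross_sph:
  assumes "sin \<theta> \<noteq> 0"
  shows "cross3 (sph \<theta> \<phi>) w =
    vector [- sin \<phi> * (sph_d\<theta> \<theta> \<phi> \<bullet> w) - cos \<theta> / sin \<theta> * cos \<phi> * (sph_d\<phi> \<theta> \<phi> \<bullet> w),
            cos \<phi> * (sph_d\<theta> \<theta> \<phi> \<bullet> w) - cos \<theta> / sin \<theta> * sin \<phi> * (sph_d\<phi> \<theta> \<phi> \<bullet> w),
            sph_d\<phi> \<theta> \<phi> \<bullet> w]"
  using assms sin_cos_squared_add[of \<theta>] sin_cos_squared_add[of \<phi>]
  unfolding vec_eq_iff forall_3 cross3_def inner_3 sph_def sph_d\<theta>_def sph_d\<phi>_def vector_3
  by (intro conjI; simp add: divide_simps; algebra)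

section \<open>Torque from the Euler-Lagrange equations of one body\<close>

text \<open>
  The hypotheses are the two Euler-Lagrange equations of a body under a force \<open>F\<close>. The angles
  are only known to be differentiable once, so their second derivatives cannot be used
  separately: the angular momentum is written in terms of the canonical momenta
  \<open>p = m \<theta>'\<close> and \<open>l = m sin\<^sup>2 \<theta> \<phi>'\<close>, whose derivatives the equations provide. The centrifugal
  term of the \<open>\<theta>\<close>-equation cancels against the derivative of the coordinate frame.
\<close>
lemma angular_momentum_has_torque:
  fixes \<theta> \<phi> :: "real \<Rightarrow> real" and F :: "real ^ 3"
  assumes J: "open J" "t \<in> J" "\<And>s. s \<in> J \<Longrightarrow> sin (\<theta> s) \<noteq> 0"
    and \<theta>: "(\<theta> has_real_derivative deriv \<theta> t) (at t)"
    and \<phi>: "(\<phi> has_real_derivative deriv \<phi> t) (at t)"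
    and EL\<theta>: "((\<lambda>s. m * deriv \<theta> s) has_real_derivative
        m * sin (\<theta> t) * cos (\<theta> t) * (deriv \<phi> t)\<^sup>2 + sph_d\<theta> (\<theta> t) (\<phi> t) \<bullet> F) (at t)"
    and EL\<phi>: "((\<lambda>s. m * (sin (\<theta> s))\<^sup>2 * deriv \<phi> s) has_real_derivative
        sph_d\<phi> (\<theta> t) (\<phi> t) \<bullet> F) (at t)"
  shows "((\<lambda>s. m *\<^sub>R cross3 (sph (\<theta> s) (\<phi> s))
             (deriv \<theta> s *\<^sub>R sph_d\<theta> (\<theta> s) (\<phi> s) + deriv \<phi> s *\<^sub>R sph_d\<phi> (\<theta> s) (\<phi> s)))
         has_vector_derivative cross3 (sph (\<theta> t) (\<phi> t)) F) (at t)"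
proof -
  define p where "p = (\<lambda>s. m * deriv \<theta> s)"
  define l where "l = (\<lambda>s. m * (sin (\<theta> s))\<^sup>2 * deriv \<phi> s)"
  \<comment> \<open>The cotangent of \<open>\<theta>\<close> is differentiable because the body avoids the poles.\<close>
  define c where "c = (\<lambda>s. cos (\<theta> s) / sin (\<theta> s))"
  define c' where "c' = deriv \<theta> t / (sin (\<theta> t))\<^sup>2"
  let ?L = "\<lambda>s. vector [- sin (\<phi> s) * p s - c s * cos (\<phi> s) * l s,
            cos (\<phi> s) * p s - c s * sin (\<phi> s) * l s,
            l s] :: real ^ 3"
  have nz: "sin (\<theta> t) \<noteq> 0" using J by blast
  have c: "(c has_real_derivative - c') (at t)"
  proof -
    have "(c has_real_derivative
        (- sin (\<theta> t) * deriv \<theta> t * sin (\<theta> t) - cos (\<theta> t) * (cos (\<theta> t) * deriv \<theta> t))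
          / (sin (\<theta> t) * sin (\<theta> t))) (at t)"
      unfolding c_def using \<theta> nz by (auto intro!: derivative_eq_intros)
    also have "- sin (\<theta> t) * deriv \<theta> t * sin (\<theta> t) - cos (\<theta> t) * (cos (\<theta> t) * deriv \<theta> t)
        = - deriv \<theta> t"
      using sin_cos_squared_add[of "\<theta> t"] by algebra
    finally show ?thesis by (simp add: c'_def power2_eq_square)
  qed
  have ct: "c t = cos (\<theta> t) / sin (\<theta> t)" by (simp add: c_def)
  have cl: "c t * l t = m * sin (\<theta> t) * cos (\<theta> t) * deriv \<phi> t"
    "c' * l t = m * deriv \<theta> t * deriv \<phi> t"
    using nz by (simp_all add: c_def c'_def l_def power2_eq_square)
  have "(?L has_vector_derivative cross3 (sph (\<theta> t) (\<phi> t)) F) (at t)"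
    unfolding cross_sph[OF nz] ct[symmetric]
  proof (intro has_vector_derivative_vector_3)
    note [derivative_intros] = EL\<theta>[folded p_def] EL\<phi>[folded l_def] c
    have p: "p t = m * deriv \<theta> t" by (simp add: p_def)
    show "((\<lambda>s. - sin (\<phi> s) * p s - c s * cos (\<phi> s) * l s) has_real_derivative
      - sin (\<phi> t) * (sph_d\<theta> (\<theta> t) (\<phi> t) \<bullet> F)
      - c t * cos (\<phi> t) * (sph_d\<phi> (\<theta> t) (\<phi> t) \<bullet> F)) (at t)"
      by (rule derivative_eq_intros \<phi> refl)+ (use p cl in algebra)
    show "((\<lambda>s. cos (\<phi> s) * p s - c s * sin (\<phi> s) * l s) has_real_derivative
      cos (\<phi> t) * (sph_d\<theta> (\<theta> t) (\<phi> t) \<bullet> F)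
      - c t * sin (\<phi> t) * (sph_d\<phi> (\<theta> t) (\<phi> t) \<bullet> F)) (at t)"
      by (rule derivative_eq_intros \<phi> refl)+ (use p cl in algebra)
    show "(l has_real_derivative sph_d\<phi> (\<theta> t) (\<phi> t) \<bullet> F) (at t)"
      using EL\<phi> by (simp add: l_def)
  qed
  then show ?thesis
  proof (rule has_vector_derivative_transform_within_open[OF _ J(1,2)])
    fix s assume "s \<in> J"
    then have "sin (\<theta> s) \<noteq> 0" by (rule J)
    then show "?L s = m *\<^sub>R cross3 (sph (\<theta> s) (\<phi> s))
             (deriv \<theta> s *\<^sub>R sph_d\<theta> (\<theta> s) (\<phi> s) + deriv \<phi> s *\<^sub>R sph_d\<phi> (\<theta> s) (\<phi> s))"
      by (simp add: cross_sph inner_add_right sph_frame p_def l_def c_def vec_eq_iff forall_3 algebra_simps)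
  qed
qed

section \<open>Pair forces and their torques\<close>

text \<open>
  The gradient with respect to \<open>x\<^sub>k\<close>, taken in the ambient space, of the term
  \<open>m\<^sub>i m\<^sub>j U (x\<^sub>i \<bullet> x\<^sub>j)\<close>. Indexing it by the pair rather than by the partner of \<open>k\<close> lets the double
  sum over \<open>i < j\<close> in the Lagrangian be differentiated term by term.
\<close>
definition pair_force :: "(nat \<Rightarrow> real) \<Rightarrow> (real \<Rightarrow> real) \<Rightarrow> (nat \<Rightarrow> real ^ 3) \<Rightarrow>
    nat \<Rightarrow> nat \<Rightarrow> nat \<Rightarrow> real ^ 3" where
  "pair_force m U x i j k = (m i * m j * deriv U (x i \<bullet> x j)) *\<^sub>R
     (if k = i then x j else if k = j then x i else 0)"

definition total_force :: "nat \<Rightarrow> (nat \<Rightarrow> real) \<Rightarrow> (real \<Rightarrow> real) \<Rightarrow> (nat \<Rightarrow> real ^ 3) \<Rightarrow>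
    nat \<Rightarrow> real ^ 3" where
  "total_force n m U x k = (\<Sum>j<n. \<Sum>i<j. pair_force m U x i j k)"

lemma bounded_bilinear_cross3: "bounded_bilinear cross3"
  using bilinear_cross bilinear_conv_bounded_bilinear by blast

text \<open>
  The pair \<open>i, j\<close> contributes \<open>x\<^sub>i \<times> x\<^sub>j + x\<^sub>j \<times> x\<^sub>i = 0\<close>, up to a common factor.
\<close>
lemma sum_torque_eq_0: "(\<Sum>k<n. cross3 (x k) (total_force n m U x k)) = 0"
proof -
  interpret c: bounded_bilinear cross3 by (rule bounded_bilinear_cross3)
  \<comment> \<open>Summing over the bodies before the pairs isolates the contribution of a single pair.\<close>
  have pair: "(\<Sum>k<n. cross3 (x k) (pair_force m U x i j k)) = 0" if "i < j" "j < n" for i j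
  proof -
    have "(\<Sum>k<n. cross3 (x k) (pair_force m U x i j k))
      = (\<Sum>k\<in>{i, j}. cross3 (x k) (pair_force m U x i j k))"
      using that by (intro sum.mono_neutral_right) (auto simp: pair_force_def)
    also have "\<dots> = 0"
      using that cross_skew[of "x i" "x j"] by (simp add: pair_force_def cross_mult_right)
    finally show ?thesis .
  qed
  have "(\<Sum>k<n. cross3 (x k) (total_force n m U x k))
    = (\<Sum>k<n. \<Sum>j<n. \<Sum>i<j. cross3 (x k) (pair_force m U x i j k))"
    by (simp add: total_force_def c.sum_right)
  also have "\<dots> = (\<Sum>j<n. \<Sum>i<j. \<Sum>k<n. cross3 (x k) (pair_force m U x i j k))"
    by (subst sum.swap, rule sum.cong[OF refl], rule sum.swap)
  also have "\<dots> = 0"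
    by (simp add: pair)
  finally show ?thesis .
qed

text \<open>
  Both coordinates of body \<open>k\<close> are treated at once: \<open>w\<close> stands for the tangent vector along
  which the chosen coordinate moves that body while all others stay fixed.
\<close>
lemma force_function_derivative:
  fixes y :: "nat \<Rightarrow> real \<Rightarrow> real ^ 3"
  assumes U: "\<And>i j. i < j \<Longrightarrow> j < n \<Longrightarrow> U differentiable (at (y i a \<bullet> y j a))"
    and y: "\<And>i. (y i has_vector_derivative (if i = k then w else 0)) (at a)"
  shows "((\<lambda>r. \<Sum>j<n. \<Sum>i<j. m i * m j * U (y i r \<bullet> y j r)) has_real_derivative
      w \<bullet> total_force n m U (\<lambda>i. y i a) k) (at a)"
  unfolding total_force_def inner_sum_right
proof (intro DERIV_sum)
  fix i j assume "j \<in> {..<n}" "i \<in> {..<j}"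
  then have ij: "i < j" "j < n" by auto
  have inner: "((\<lambda>r. y i r \<bullet> y j r) has_real_derivative
      (y i a \<bullet> (if j = k then w else 0) + (if i = k then w else 0) \<bullet> y j a)) (at a)"
    unfolding has_real_derivative_iff_has_vector_derivative
    by (rule bounded_bilinear.has_vector_derivative[OF bounded_bilinear_inner y y])
  have "(U has_real_derivative deriv U (y i a \<bullet> y j a)) (at (y i a \<bullet> y j a))"
    using U[OF ij] by (simp add: DERIV_deriv_iff_real_differentiable)
  from DERIV_cmult[OF DERIV_chain2[OF this inner], of "m i * m j"]
  show "((\<lambda>r. m i * m j * U (y i r \<bullet> y j r)) has_real_derivative
      w \<bullet> pair_force m U (\<lambda>i. y i a) i j k) (at a)"
    using ij by (simp add: pair_force_def inner_commute mult_ac split: if_splits)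
qed

section \<open>Partial derivatives of the Lagrangian\<close>

lemma lagrangian_inner: "lagrangian n m U \<theta> \<phi> u v =
     (\<Sum>k<n. m k / 2 * ((u k)\<^sup>2 + (sin (\<theta> k))\<^sup>2 * (v k)\<^sup>2)) +
     (\<Sum>j<n. \<Sum>i<j. m i * m j * U (sph (\<theta> i) (\<phi> i) \<bullet> sph (\<theta> j) (\<phi> j)))"
  by (simp add: lagrangian_def cos_arc_angle)

text \<open>The kinetic energy is separable, so only the summand of the varied body matters.\<close>
lemma sum_fun_upd_derivative:
  fixes x :: "nat \<Rightarrow> real" and g :: "nat \<Rightarrow> real \<Rightarrow> real"
  assumes "k < n" "(g k has_real_derivative d) (at (x k))"
  shows "((\<lambda>r. \<Sum>i<n. g i ((x(k := r)) i)) has_real_derivative d) (at (x k))"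
proof -
  have eq: "(\<Sum>i<n. g i ((x(k := r)) i)) = (\<Sum>i\<in>{..<n}-{k}. g i (x i)) + g k r" for r
    using assms(1) by (subst sum.remove[of _ k]) (auto intro!: sum.cong)
  show ?thesis
    unfolding eq by (auto intro!: derivative_eq_intros assms)
qed

lemma partial_deriv_\<theta>_velocity:
  assumes "k < n"
  shows "partial_deriv (\<lambda>u. lagrangian n m U \<theta> \<phi> u v) k u = m k * u k"
  unfolding partial_deriv_def lagrangian_inner
  by (rule DERIV_imp_deriv, rule derivative_eq_intros,
      rule sum_fun_upd_derivative[OF assms, where
        g = "\<lambda>i r. m i / 2 * (r\<^sup>2 + (sin (\<theta> i))\<^sup>2 * (v i)\<^sup>2)"])
    (auto intro!: derivative_eq_intros)

lemma partial_deriv_\<phi>_velocity: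
  assumes "k < n"
  shows "partial_deriv (\<lambda>v. lagrangian n m U \<theta> \<phi> u v) k v = m k * (sin (\<theta> k))\<^sup>2 * v k"
  unfolding partial_deriv_def lagrangian_inner
  by (rule DERIV_imp_deriv, rule derivative_eq_intros,
      rule sum_fun_upd_derivative[OF assms, where
        g = "\<lambda>i r. m i / 2 * ((u i)\<^sup>2 + (sin (\<theta> i))\<^sup>2 * r\<^sup>2)"])
    (auto intro!: derivative_eq_intros)

lemma partial_deriv_\<theta>:
  fixes \<theta> \<phi> :: "nat \<Rightarrow> real"
  defines "x \<equiv> \<lambda>i. sph (\<theta> i) (\<phi> i)"
  assumes "k < n"
    and U: "\<And>i j. i < j \<Longrightarrow> j < n \<Longrightarrow> U differentiable (at (x i \<bullet> x j))"
  shows "partial_deriv (\<lambda>\<theta>. lagrangian n m U \<theta> \<phi> u v) k \<theta>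
    = m k * sin (\<theta> k) * cos (\<theta> k) * (v k)\<^sup>2 + sph_d\<theta> (\<theta> k) (\<phi> k) \<bullet> total_force n m U x k"
  unfolding partial_deriv_def lagrangian_inner
proof (rule DERIV_imp_deriv, rule DERIV_add)
  show "((\<lambda>s. \<Sum>i<n. m i / 2 * ((u i)\<^sup>2 + (sin ((\<theta>(k := s)) i))\<^sup>2 * (v i)\<^sup>2)) has_real_derivative
      m k * sin (\<theta> k) * cos (\<theta> k) * (v k)\<^sup>2) (at (\<theta> k))"
    by (rule sum_fun_upd_derivative[OF assms(2), where
        g = "\<lambda>i r. m i / 2 * ((u i)\<^sup>2 + (sin r)\<^sup>2 * (v i)\<^sup>2)"])
      (auto intro!: derivative_eq_intros)
  have y: "((\<lambda>s. sph ((\<theta>(k := s)) i) (\<phi> i)) has_vector_derivative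
      (if i = k then sph_d\<theta> (\<theta> k) (\<phi> k) else 0)) (at (\<theta> k))" for i
    using has_vector_derivative_sph[of "\<lambda>s. s" 1 "\<theta> k" "\<lambda>s. \<phi> k" 0] by auto
  show "((\<lambda>s. \<Sum>j<n. \<Sum>i<j. m i * m j *
        U (sph ((\<theta>(k := s)) i) (\<phi> i) \<bullet> sph ((\<theta>(k := s)) j) (\<phi> j))) has_real_derivative
      sph_d\<theta> (\<theta> k) (\<phi> k) \<bullet> total_force n m U x k) (at (\<theta> k))"
    using force_function_derivative[where y = "\<lambda>i s. sph ((\<theta>(k := s)) i) (\<phi> i)", OF _ y] U
    by (simp add: x_def)
qed

lemma partial_deriv_\<phi>:
  fixes \<theta> \<phi> :: "nat \<Rightarrow> real"
  defines "x \<equiv> \<lambda>i. sph (\<theta> i) (\<phi> i)"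
  assumes U: "\<And>i j. i < j \<Longrightarrow> j < n \<Longrightarrow> U differentiable (at (x i \<bullet> x j))"
  shows "partial_deriv (\<lambda>\<phi>. lagrangian n m U \<theta> \<phi> u v) k \<phi>
    = sph_d\<phi> (\<theta> k) (\<phi> k) \<bullet> total_force n m U x k"
  unfolding partial_deriv_def lagrangian_inner
proof (rule DERIV_imp_deriv)
  have y: "((\<lambda>s. sph (\<theta> i) ((\<phi>(k := s)) i)) has_vector_derivative
      (if i = k then sph_d\<phi> (\<theta> k) (\<phi> k) else 0)) (at (\<phi> k))" for i
    using has_vector_derivative_sph[of "\<lambda>s. \<theta> k" 0 "\<phi> k" "\<lambda>s. s" 1] by auto
  have "((\<lambda>s. \<Sum>j<n. \<Sum>i<j. m i * m j *
        U (sph (\<theta> i) ((\<phi>(k := s)) i) \<bullet> sph (\<theta> j) ((\<phi>(k := s)) j))) has_real_derivative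
      sph_d\<phi> (\<theta> k) (\<phi> k) \<bullet> total_force n m U x k) (at (\<phi> k))"
    using force_function_derivative[where y = "\<lambda>i s. sph (\<theta> i) ((\<phi>(k := s)) i)", OF _ y] U
    by (simp add: x_def)
  from DERIV_add[OF DERIV_const this]
  show "((\<lambda>s. (\<Sum>i<n. m i / 2 * ((u i)\<^sup>2 + (sin (\<theta> i))\<^sup>2 * (v i)\<^sup>2)) +
      (\<Sum>j<n. \<Sum>i<j. m i * m j *
        U (sph (\<theta> i) ((\<phi>(k := s)) i) \<bullet> sph (\<theta> j) ((\<phi>(k := s)) j)))) has_real_derivative
      sph_d\<phi> (\<theta> k) (\<phi> k) \<bullet> total_force n m U x k) (at (\<phi> k))"
    by simp
qed

section \<open>Conservation of angular momentum\<close>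

text \<open>
  The conservation law near one instant, in the axes \<open>S\<close> of the chart around that instant. The
  velocities \<open>v\<close> are exposed because a comparison with another frame needs the angular
  momentum as a function on the whole neighbourhood \<open>J\<close>.
\<close>
lemma solution_angular_momentum_stationary_in_chart:
  assumes sol: "solution n m U q" and U: "admissible_potential U"
  obtains J S x v where "open J" "t \<in> J" "rotation_matrix S"
    "\<And>k s. k < n \<Longrightarrow> s \<in> J \<Longrightarrow> x k s = S *v q k s"
    "\<And>k s. k < n \<Longrightarrow> s \<in> J \<Longrightarrow> (x k has_vector_derivative v k s) (at s)"
    "((\<lambda>s. \<Sum>k<n. m k *\<^sub>R cross3 (x k s) (v k s)) has_vector_derivative 0) (at t)"
proof -
  obtain J S \<theta> \<phi> where J: "open J" "t \<in> J" and sc: "spherical_coords_on J S n q \<theta> \<phi>"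
    and nz: "\<And>k s. k < n \<Longrightarrow> s \<in> J \<Longrightarrow> sin (\<theta> k s) \<noteq> 0"
    and EL: "euler_lagrange_on J n (lagrangian n m U) \<theta> \<phi>"
    using sol unfolding solution_def by metis
  define x where "x k s = sph (\<theta> k s) (\<phi> k s)" for k s
  define v where "v k s = deriv (\<theta> k) s *\<^sub>R sph_d\<theta> (\<theta> k s) (\<phi> k s)
      + deriv (\<phi> k) s *\<^sub>R sph_d\<phi> (\<theta> k s) (\<phi> k s)" for k s
  have xq: "x k s = S *v q k s" if "k < n" "s \<in> J" for k s
    using sc that by (auto simp: spherical_coords_on_def x_def)
  have S: "rotation_matrix S" using sc by (auto simp: spherical_coords_on_def)
  have d\<theta>: "(\<theta> k has_real_derivative deriv (\<theta> k) s) (at s)"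
    and d\<phi>: "(\<phi> k has_real_derivative deriv (\<phi> k) s) (at s)" if "k < n" "s \<in> J" for k s
    using EL that unfolding euler_lagrange_on_def by (auto simp: DERIV_deriv_iff_real_differentiable)
  have inj: "a = b" if "S *v a = S *v b" for a b
    using S that inj_matrix_vector_mult[of S]
    by (metis injD invertible_def orthogonal_matrix_def rotation_matrix_def)
  have Udiff: "U differentiable (at (x i t \<bullet> x j t))" if "i < j" "j < n" for i j
  proof -
    have "i < n" "i \<noteq> j" using that by auto
    then have q: "q i t \<noteq> q j t" "q i t \<noteq> - q j t"
      using sol that(2) unfolding solution_def by auto
    have "x i t \<noteq> x j t" "x i t \<noteq> - x j t"
      using q inj[of "q i t" "q j t"] inj[of "q i t" "- q j t"] xq J \<open>i < n\<close> \<open>j < n\<close>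
      by (auto simp: linear_neg[OF matrix_vector_mul_linear])
    then have "\<bar>x i t \<bullet> x j t\<bar> < 1"
      by (intro abs_inner_less_1) (auto simp: x_def)
    then have "arccos (x i t \<bullet> x j t) \<in> {0<..<pi}" "cos (arccos (x i t \<bullet> x j t)) = x i t \<bullet> x j t"
      using arccos_lt_bounded[of "x i t \<bullet> x j t"] by auto
    then show ?thesis
      using U unfolding admissible_potential_def by metis
  qed
  have torque: "((\<lambda>s. m k *\<^sub>R cross3 (x k s) (v k s)) has_vector_derivative
      cross3 (x k t) (total_force n m U (\<lambda>i. x i t) k)) (at t)" if k: "k < n" for k
    unfolding x_def v_def
  proof (rule angular_momentum_has_torque[OF J nz[OF k] d\<theta>[OF k J(2)] d\<phi>[OF k J(2)]])
    note el = EL[unfolded euler_lagrange_on_def, rule_format, OF k J(2)]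
    note pd = partial_deriv_\<theta>_velocity[OF k] partial_deriv_\<phi>_velocity[OF k]
      partial_deriv_\<theta>[OF k] partial_deriv_\<phi>
    show "((\<lambda>s. m k * deriv (\<theta> k) s) has_real_derivative
        m k * sin (\<theta> k t) * cos (\<theta> k t) * (deriv (\<phi> k) t)\<^sup>2 + sph_d\<theta> (\<theta> k t) (\<phi> k t) \<bullet>
          total_force n m U (\<lambda>i. sph (\<theta> i t) (\<phi> i t)) k) (at t)"
      using el Udiff by (simp add: pd at_time_def velocity_def x_def)
    show "((\<lambda>s. m k * (sin (\<theta> k s))\<^sup>2 * deriv (\<phi> k) s) has_real_derivative
        sph_d\<phi> (\<theta> k t) (\<phi> k t) \<bullet> total_force n m U (\<lambda>i. sph (\<theta> i t) (\<phi> i t)) k) (at t)"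
      using el Udiff by (simp add: pd at_time_def velocity_def x_def)
  qed
  show thesis
  proof (rule that[of J S x v])
    show "(x k has_vector_derivative v k s) (at s)" if "k < n" "s \<in> J" for k s
      using has_vector_derivative_sph[OF d\<theta>[OF that] d\<phi>[OF that]]
      by (simp add: v_def x_def[abs_def])
    have "((\<lambda>s. \<Sum>k<n. m k *\<^sub>R cross3 (x k s) (v k s)) has_vector_derivative
        (\<Sum>k<n. cross3 (x k t) (total_force n m U (\<lambda>i. x i t) k))) (at t)"
      by (intro has_vector_derivative_sum torque) auto
    then show "((\<lambda>s. \<Sum>k<n. m k *\<^sub>R cross3 (x k s) (v k s)) has_vector_derivative 0) (at t)"
      by (simp add: sum_torque_eq_0)
  qed (use J S xq in auto)
qed

text \<open>
  The rotation from the axes \<open>R\<close> to those of the local chart is constant in time, so it carries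
  velocities to velocities and angular momentum to angular momentum. In a frame in which the
  accelerations \<open>a\<close> exist, the derivative of \<open>x \<times> v\<close> is \<open>x \<times> a\<close>, because \<open>v \<times> v = 0\<close>.
\<close>
lemma solution_moment_of_accelerations_zero:
  assumes sol: "solution n m U q" and U: "admissible_potential U"
    and R: "rotation_matrix R"
    and v: "\<And>k s. k < n \<Longrightarrow> ((\<lambda>s. R *v q k s) has_vector_derivative v k s) (at s)"
    and a: "\<And>k. k < n \<Longrightarrow> (v k has_vector_derivative a k) (at t)"
  shows "(\<Sum>k<n. m k *\<^sub>R cross3 (R *v q k t) (a k)) = 0"
proof -
  obtain J S x w where J: "open J" "t \<in> J" and S: "rotation_matrix S"
    and x: "\<And>k s. k < n \<Longrightarrow> s \<in> J \<Longrightarrow> x k s = S *v q k s"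
    and w: "\<And>k s. k < n \<Longrightarrow> s \<in> J \<Longrightarrow> (x k has_vector_derivative w k s) (at s)"
    and L: "((\<lambda>s. \<Sum>k<n. m k *\<^sub>R cross3 (x k s) (w k s)) has_vector_derivative 0) (at t)"
    by (rule solution_angular_momentum_stationary_in_chart[OF sol U, where t = t]) (rule that)
  define M where "M = S ** transpose R"
  have M: "rotation_matrix M"
    using R S by (auto simp: M_def rotation_matrix_def orthogonal_matrix_mul det_mul det_transpose
        orthogonal_matrix_transpose)
  have MR: "M *v (R *v z) = S *v z" for z
    using R by (simp add: M_def matrix_vector_mul_assoc matrix_mul_assoc[symmetric]
        rotation_matrix_def orthogonal_matrix)
  interpret M: bounded_linear "(*v) M" by simp
  have w_eq: "w k s = M *v v k s" if "k < n" "s \<in> J" for k s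
  proof -
    have "((\<lambda>s. M *v (R *v q k s)) has_vector_derivative M *v v k s) (at s)"
      by (rule M.has_vector_derivative[OF v[OF that(1)]])
    then have "(x k has_vector_derivative M *v v k s) (at s)"
      by (rule has_vector_derivative_transform_within_open[OF _ J(1) that(2)])
        (simp add: MR x that)
    then show ?thesis
      using vector_derivative_unique_at w[OF that] by blast
  qed
  let ?T = "\<Sum>k<n. m k *\<^sub>R cross3 (R *v q k t) (a k)"
  have "((\<lambda>s. \<Sum>k<n. m k *\<^sub>R cross3 (R *v q k s) (v k s)) has_vector_derivative
      (\<Sum>k<n. m k *\<^sub>R (cross3 (R *v q k t) (a k) + cross3 (v k t) (v k t)))) (at t)"
    by (intro has_vector_derivative_sum bounded_linear.has_vector_derivative[OF bounded_linear_scaleR_right]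
      bounded_bilinear.has_vector_derivative[OF bounded_bilinear_cross3] v a) auto
  then have "((\<lambda>s. \<Sum>k<n. m k *\<^sub>R cross3 (R *v q k s) (v k s)) has_vector_derivative ?T) (at t)"
    by simp
  from M.has_vector_derivative[OF this]
  have "((\<lambda>s. \<Sum>k<n. m k *\<^sub>R cross3 (x k s) (w k s)) has_vector_derivative M *v ?T) (at t)"
    by (rule has_vector_derivative_transform_within_open[OF _ J])
      (simp add: M.sum M.scaleR cross_rotation_matrix[OF M, symmetric] MR x w_eq)
  then have "M *v ?T = 0"
    using L vector_derivative_unique_at by blast
  then have "transpose M *v (M *v ?T) = 0" by simp
  then show ?thesis
    using M by (simp add: matrix_vector_mul_assoc rotation_matrix_def orthogonal_matrix)
qed

section \<open>The rotation axis\<close>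

lemma eigenvector_inertia_tensor_z:
  assumes "(\<Sum>k<n. m k * (x k $ 1) * (x k $ 3)) = 0" "(\<Sum>k<n. m k * (x k $ 2) * (x k $ 3)) = 0"
  shows "eigenvector (inertia_tensor n m x) (vector [0, 0, 1])"
  unfolding eigenvector_def
proof (intro conjI exI)
  show "(vector [0, 0, 1] :: real ^ 3) \<noteq> 0"
    by (simp add: vec_eq_iff forall_3)
  show "inertia_tensor n m x *v vector [0, 0, 1]
      = (\<Sum>k<n. m k * ((x k $ 1)\<^sup>2 + (x k $ 2)\<^sup>2)) *\<^sub>R vector [0, 0, 1]"
    using assms
    by (simp add: vec_eq_iff forall_3 inertia_tensor_def Let_def matrix_vector_mult_def sum_3)
qed

theorem theorem1:
  fixes n :: nat and m :: "nat \<Rightarrow> real" and U :: "real \<Rightarrow> real"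
    and q :: "nat \<Rightarrow> real \<Rightarrow> real ^ 3" and R :: "real ^ 3 ^ 3"
    and \<theta> \<phi> :: "nat \<Rightarrow> real \<Rightarrow> real" and \<omega> :: real
  assumes "\<And>k. k < n \<Longrightarrow> m k > 0"
    and "admissible_potential U"
    and "relative_equilibrium n m U q R \<theta> \<phi> \<omega>"
    and "\<omega> \<noteq> 0"
  shows "\<forall>t. eigenvector (inertia_tensor n m (\<lambda>k. R *v q k t)) (vector [0, 0, 1])"
proof
  fix t
  define y where "y k s = R *v q k s" for k s
  have sol: "solution n m U q" and chart: "spherical_coords_on UNIV R n q \<theta> \<phi>"
    and rigid: "\<And>k s. k < n \<Longrightarrow>
      (\<theta> k has_real_derivative 0) (at s) \<and> \<phi> k s = \<phi> k 0 + \<omega> * s"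
    using assms(3) unfolding relative_equilibrium_def by (iprover)+
  have R: "rotation_matrix R"
    using chart unfolding spherical_coords_on_def by iprover
  have y: "y k s = sph (\<theta> k 0) (\<phi> k 0 + \<omega> * s)" if "k < n" for k s
  proof -
    have "\<forall>s. (\<theta> k has_real_derivative 0) (at s)"
      using rigid[OF that, THEN conjunct1] by iprover
    then have "\<theta> k s = \<theta> k 0"
      by (rule DERIV_isconst_all)
    moreover have "y k s = sph (\<theta> k s) (\<phi> k s)"
      using chart that by (simp add: y_def spherical_coords_on_def)
    ultimately show ?thesis
      by (simp only: rigid[OF that, of s, THEN conjunct2])
  qed
  define v where "v k s = \<omega> *\<^sub>R (vector [- (y k s $ 2), y k s $ 1, 0] :: real ^ 3)" for k s
  define a where "a k = - \<omega>\<^sup>2 *\<^sub>R (vector [y k t $ 1, y k t $ 2, 0] :: real ^ 3)" for k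
  have v: "(y k has_vector_derivative v k s) (at s)" if "k < n" for k s
  proof -
    have "((\<lambda>s. sph (\<theta> k 0) (\<phi> k 0 + \<omega> * s)) has_vector_derivative
        0 *\<^sub>R sph_d\<theta> (\<theta> k 0) (\<phi> k 0 + \<omega> * s) + \<omega> *\<^sub>R sph_d\<phi> (\<theta> k 0) (\<phi> k 0 + \<omega> * s)) (at s)"
      by (rule has_vector_derivative_sph) (auto intro!: derivative_eq_intros)
    also have "0 *\<^sub>R sph_d\<theta> (\<theta> k 0) (\<phi> k 0 + \<omega> * s) + \<omega> *\<^sub>R sph_d\<phi> (\<theta> k 0) (\<phi> k 0 + \<omega> * s)
        = v k s"
      by (simp add: v_def y[OF that] sph_def sph_d\<phi>_def)
    also have "(\<lambda>s. sph (\<theta> k 0) (\<phi> k 0 + \<omega> * s)) = y k"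
      by (simp add: fun_eq_iff y[OF that])
    finally show ?thesis .
  qed
  have a: "(v k has_vector_derivative a k) (at t)" if "k < n" for k
  proof -
    have comp: "((\<lambda>s. y k s $ i) has_real_derivative v k t $ i) (at t)" for i
      unfolding has_real_derivative_iff_has_vector_derivative
      by (rule bounded_linear.has_vector_derivative[OF bounded_linear_vec_nth v[OF that]])
    have "((\<lambda>s. vector [- (\<omega> * y k s $ 2), \<omega> * y k s $ 1, 0] :: real ^ 3) has_vector_derivative
        vector [- (\<omega> * v k t $ 2), \<omega> * v k t $ 1, 0]) (at t)"
      by (intro has_vector_derivative_vector_3 DERIV_minus DERIV_cmult comp DERIV_const)
    also have "vector [- (\<omega> * v k t $ 2), \<omega> * v k t $ 1, 0] = a k"
      by (simp add: vec_eq_iff forall_3 v_def a_def power2_eq_square)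
    also have "(\<lambda>s. vector [- (\<omega> * y k s $ 2), \<omega> * y k s $ 1, 0] :: real ^ 3) = v k"
      by (simp add: fun_eq_iff vec_eq_iff forall_3 v_def)
    finally show ?thesis .
  qed
  have "(\<Sum>k<n. m k *\<^sub>R cross3 (y k t) (a k)) = 0"
    unfolding y_def
    by (rule solution_moment_of_accelerations_zero[OF sol assms(2) R])
      (use v a in \<open>auto simp: y_def[abs_def]\<close>)
  also have "(\<Sum>k<n. m k *\<^sub>R cross3 (y k t) (a k)) = \<omega>\<^sup>2 *\<^sub>R
      vector [\<Sum>k<n. m k * (y k t $ 2) * (y k t $ 3), - (\<Sum>k<n. m k * (y k t $ 1) * (y k t $ 3)), 0]"
    by (simp add: vec_eq_iff forall_3 cross_components a_def sum_distrib_left sum_negf mult_ac)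
  finally have "(\<Sum>k<n. m k * (y k t $ 1) * (y k t $ 3)) = 0"
    "(\<Sum>k<n. m k * (y k t $ 2) * (y k t $ 3)) = 0"
    using assms(4) by (auto simp: vec_eq_iff forall_3)
  then show "eigenvector (inertia_tensor n m (\<lambda>k. R *v q k t)) (vector [0, 0, 1])"
    unfolding y_def by (rule eigenvector_inertia_tensor_z)
qed

end
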